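(* Fix $\epsilon>0$ independent of $n$. Let $p\ge1/2$, $q=1-p$, and define $\gamma$ by $q=n^{-\gamma}$. For $\epsilon\le\gamma/2$, $k=n^{1/2+\epsilon}/q^{1/2}$ and $\ell\le n^{1/4-0.001}$, the norm of the degree-$f(1/\epsilon)$ likelihood ratio between $B(k,n,\ell,p)$ and $B(k,n,p)$ is $1+o(1)$ as $n\to\infty$, for any function $f$ independent of $n$. On the other hand, for $\epsilon\ge\gamma$, $k=n^{1/2+\epsilon}/q^{1/2}$ and all $\ell$, the norm of the degree-$O(1/\epsilon)$ likelihood ratio between $B(k,n,\ell,p)$ and $B(k,n,p)$ is unbounded as $n\to\infty$.
   Context: $D_{\mathrm{null}}=B(k,n,p)$: bipartite graphs $H=(U,V,E)$ with $|U|=k$, $|V|=n$, each pair $\{u,v\}$ ($u\in U,v\in V$) an edge independently with probability $p$. $D_{\mathrm{planted}}=B(k,n,\ell,p)$: choose $S\subseteq U$ by including each vertex of $U$ independently with probability $\ell/k$; choose $P\subseteq V$ by including each vertex of $V$ independently with probability $(k-\ell)/n$; then independently include each pair $\{u,v\}$ ($u\in U,v\in V$) with probability $1$ if $u\in S,v\in P$; with probability $\frac{np-(k-\ell)}{n-(k-\ell)}$ if $u\in S,v\notin P$; and with probability $p$ otherwise. The degree-$D$ likelihood ratio is the orthogonal projection in $L^2(D_{\mathrm{null}})$ of $dD_{\mathrm{planted}}/dD_{\mathrm{null}}$ onto polynomials of degree at most $D$ in the edge indicator variables; its norm is the $L^2(D_{\mathrm{null}})$ norm. $O(1/\epsilon)$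 denotes a sufficiently large constant multiple of $1/\epsilon$.
   Formalization: The first claim is proved for k ≤ (1-δ)n with a fixed δ>0 (it fails e.g. for k=n, γ=0.9, ε=0.05, ℓ=n^0.2); in the second, "all ℓ" means 0<ℓ<k (for ℓ=0 or ℓ=k the two models coincide) and the degree is at least 2 (at degree at most 1 the norm is 1). *)

theory Defs
  imports "HOL-Probability.Probability"
begin

text \<open>
  A bipartite graph with left side \<open>U = {..<k}\<close> and right side \<open>V = {..<n}\<close> is encoded by the
  indicator function of its edge set, a function on pairs that is \<open>False\<close> outside \<open>U \<times> V\<close>.
\<close>

type_synonym bigraph = "nat \<times> nat \<Rightarrow> bool"

definition vpairs :: "nat \<Rightarrow> nat \<Rightarrow> (nat \<times> nat) set" where
  "vpairs k n = {..<k} \<times> {..<n}"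

definition B_null :: "nat \<Rightarrow> nat \<Rightarrow> real \<Rightarrow> bigraph pmf" where
  "B_null k n p = Pi_pmf (vpairs k n) False (\<lambda>_. bernoulli_pmf p)"

definition planted_edge_prob ::
    "nat \<Rightarrow> nat \<Rightarrow> nat \<Rightarrow> real \<Rightarrow> bool \<Rightarrow> bool \<Rightarrow> real" where
  "planted_edge_prob k n l p inS inP =
     (if inS \<and> inP then 1
      else if inS then (real n * p - (real k - real l)) / (real n - (real k - real l))
      else p)"

definition B_planted :: "nat \<Rightarrow> nat \<Rightarrow> nat \<Rightarrow> real \<Rightarrow> bigraph pmf" where
  "B_planted k n l p =
     do {
       S \<leftarrow> Pi_pmf {..<k} False (\<lambda>_. bernoulli_pmf (real l / real k));
       P \<leftarrow> Pi_pmf {..<n} False (\<lambda>_. bernoulli_pmf ((real k - real l) / real n));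
       Pi_pmf (vpairs k n) False
         (\<lambda>(u, v). bernoulli_pmf (planted_edge_prob k n l p (S u) (P v)))
     }"

text \<open>
  \<open>bernoulli_pmf\<close> clips its parameter to \<open>[0,1]\<close>. The following says that no clipping occurs:
  together with \<open>p < 1\<close>, \<open>k > 0\<close> and \<open>n > 0\<close> it is equivalent to all the probabilities above lying
  in \<open>[0,1]\<close> with a positive denominator \<open>n - (k - l)\<close>.
\<close>

definition model_ok :: "nat \<Rightarrow> nat \<Rightarrow> nat \<Rightarrow> real \<Rightarrow> bool" where
  "model_ok k n l p \<longleftrightarrow> l \<le> k \<and> real k - real l \<le> real n * p"

definition likelihood_ratio :: "nat \<Rightarrow> nat \<Rightarrow> nat \<Rightarrow> real \<Rightarrow> bigraph \<Rightarrow> real" where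
  "likelihood_ratio k n l p H =
     enn2real (RN_deriv (measure_pmf (B_null k n p)) (measure_pmf (B_planted k n l p)) H)"

text \<open>
  Polynomial functions of degree at most \<open>D\<close> in the edge indicators; \<open>m\<close> ranges over the exponent
  vectors of the monomials.
\<close>

definition edge_exponents :: "nat \<Rightarrow> nat \<Rightarrow> nat \<Rightarrow> (nat \<times> nat \<Rightarrow> nat) set" where
  "edge_exponents k n D = {m. (\<forall>e. e \<notin> vpairs k n \<longrightarrow> m e = 0) \<and> sum m (vpairs k n) \<le> D}"

definition edge_polys :: "nat \<Rightarrow> nat \<Rightarrow> nat \<Rightarrow> (bigraph \<Rightarrow> real) set" where
  "edge_polys k n D =
     {g. \<exists>c. \<forall>H. g H = (\<Sum>m\<in>edge_exponents k n D. c m * (\<Prod>e\<in>vpairs k n. of_bool (H e) ^ m e))}"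

definition l2_inner :: "'a pmf \<Rightarrow> ('a \<Rightarrow> real) \<Rightarrow> ('a \<Rightarrow> real) \<Rightarrow> real" where
  "l2_inner M f g = measure_pmf.expectation M (\<lambda>x. f x * g x)"

definition l2_norm :: "'a pmf \<Rightarrow> ('a \<Rightarrow> real) \<Rightarrow> real" where
  "l2_norm M f = sqrt (l2_inner M f f)"

definition is_orth_proj ::
    "'a pmf \<Rightarrow> ('a \<Rightarrow> real) set \<Rightarrow> ('a \<Rightarrow> real) \<Rightarrow> ('a \<Rightarrow> real) \<Rightarrow> bool" where
  "is_orth_proj M W f g \<longleftrightarrow> g \<in> W \<and> (\<forall>h\<in>W. l2_inner M (\<lambda>x. f x - g x) h = 0)"

text \<open>
  The projection is unique up to null sets, so its norm does not depend on the choice made by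
  \<open>SOME\<close>.
\<close>

definition low_degree_LR :: "nat \<Rightarrow> nat \<Rightarrow> nat \<Rightarrow> nat \<Rightarrow> real \<Rightarrow> bigraph \<Rightarrow> real" where
  "low_degree_LR D k n l p =
     (SOME g. is_orth_proj (B_null k n p) (edge_polys k n D) (likelihood_ratio k n l p) g)"

definition low_degree_LR_norm :: "nat \<Rightarrow> nat \<Rightarrow> nat \<Rightarrow> nat \<Rightarrow> real \<Rightarrow> real" where
  "low_degree_LR_norm D k n l p = l2_norm (B_null k n p) (low_degree_LR D k n l p)"

text \<open>
  The parameters at a given \<open>n\<close>: \<open>p \<ge> 1/2\<close>, \<open>q = 1 - p = n\<^sup>-\<^sup>\<gamma>\<close> (hence \<open>p < 1\<close>), and the integer \<open>k\<close>
  is \<open>n\<^sup>1\<^sup>/\<^sup>2\<^sup>+\<^sup>\<epsilon> / q\<^sup>1\<^sup>/\<^sup>2\<close> rounded up or down.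
\<close>

definition regime ::
    "real \<Rightarrow> nat \<Rightarrow> real \<Rightarrow> real \<Rightarrow> nat \<Rightarrow> nat \<Rightarrow> bool" where
  "regime \<epsilon> n p \<gamma> k l \<longleftrightarrow>
     p \<ge> 1/2 \<and> 1 - p = real n powr (- \<gamma>) \<and>
     \<bar>real k - real n powr (1/2 + \<epsilon>) / sqrt (1 - p)\<bar> < 1 \<and>
     model_ok k n l p"

end

theory Submission
  imports Defs
begin

text \<open>
  Write \<open>q = 1 - p\<close>, \<open>s = l / k\<close> and \<open>a = (k - l) / n\<close>. By Parseval, the squared norm of the degree-\<open>D\<close>
  likelihood ratio is the sum, over edge sets \<open>T\<close> with at most \<open>D\<close> edges, of the squared planted
  expectation of the normalised character of \<open>T\<close>. Conditionally on \<open>S\<close> and \<open>P\<close> the edges are independent,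
  so this expectation is \<open>s\<close> to the number of left vertices of \<open>T\<close>, times one moment \<open>M d\<close> of a
  two-point distribution for every right vertex of degree \<open>d\<close>. The model is calibrated so that \<open>M 1 = 0\<close>;
  for \<open>2 \<le> d \<le> D\<close> one has \<open>M d = O(q a)\<close>, and \<open>M 2 \<ge> q a\<close>.

  Upper bound: up to a constant, the weight of nonempty edge sets is at most
  \<open>(exp (k s\<^sup>2) - 1) exp (O(n q\<^sup>2 a\<^sup>2))\<close>. Here \<open>k s\<^sup>2 = l\<^sup>2 / k\<close> tends to 0, while
  \<open>n q\<^sup>2 a\<^sup>2 = O(q n\<^bsup>2\<epsilon>\<^esup>)\<close> is bounded because \<open>2\<epsilon> \<le> \<gamma>\<close>.

  Lower bound: the copies of the complete bipartite graph with 2 left and \<open>m\<close> right vertices have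
  weight of order \<open>k\<^sup>2 s\<^sup>4 (n q\<^sup>2 a\<^sup>2)\<^sup>m\<close>. If \<open>l \<ge> k / 2\<close>, then \<open>m = 1\<close> suffices. Otherwise
  \<open>n q\<^sup>2 a\<^sup>2\<close> is at least of order \<open>n\<^sup>\<epsilon>\<close>, which outweighs \<open>k\<^sup>2 s\<^sup>4 \<ge> k\<^sup>-\<^sup>2\<close> as soon as \<open>m \<ge> 3 / \<epsilon>\<close>.
\<close>

section \<open>Expectations over product distributions and orthogonal projections\<close>

text \<open>Finite supports make the expectation a finite sum over choice functions, which
  distributivity turns into a product of sums.\<close>

lemma expectation_prod_Pi_pmf_finite:
  fixes f :: "'a \<Rightarrow> 'b \<Rightarrow> real"
  assumes "finite A" and fin: "\<And>x. x \<in> A \<Longrightarrow> finite (set_pmf (p x))"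
  shows "measure_pmf.expectation (Pi_pmf A d p) (\<lambda>y. \<Prod>x\<in>A. f x (y x)) =
           (\<Prod>x\<in>A. measure_pmf.expectation (p x) (f x))"
proof -
  let ?S = "\<lambda>x. set_pmf (p x)"
  \<comment> \<open>Functions in \<open>PiE\<close> are \<open>undefined\<close> outside
    \<open>A\<close>, those in the support of \<open>Pi_pmf\<close> are \<open>d\<close> there; this
    map translates between the two.\<close>
  have inj: "inj_on (\<lambda>h x. if x \<in> A then h x else d) (PiE A ?S)"
    by (intro inj_onI ext) (metis PiE_arb)
  have "measure_pmf.expectation (Pi_pmf A d p) (\<lambda>y. \<Prod>x\<in>A. f x (y x)) =
          (\<Sum>h\<in>PiE_dflt A d ?S. (\<Prod>x\<in>A. f x (h x)) * pmf (Pi_pmf A d p) h)"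
    using assms by (intro integral_measure_pmf_real finite_PiE_dflt) (auto simp: set_Pi_pmf o_def)
  also have "\<dots> = (\<Sum>h\<in>PiE_dflt A d ?S. \<Prod>x\<in>A. f x (h x) * pmf (p x) (h x))"
    using assms by (intro sum.cong refl) (auto simp: pmf_Pi PiE_dflt_def prod.distrib)
  also have "\<dots> = (\<Sum>h\<in>PiE A ?S. \<Prod>x\<in>A. f x (h x) * pmf (p x) (h x))"
    unfolding dflt_image_PiE[symmetric] by (subst sum.reindex[OF inj]) (simp add: o_def)
  also have "\<dots> = (\<Prod>x\<in>A. \<Sum>v\<in>?S x. f x v * pmf (p x) v)"
    using assms by (subst prod_sum_PiE) auto
  also have "\<dots> = (\<Prod>x\<in>A. measure_pmf.expectation (p x) (f x))"
    using fin by (intro prod.cong refl integral_measure_pmf_real[symmetric]) auto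
  finally show ?thesis .
qed

section \<open>Finite supports and change of measure\<close>

lemma finite_vpairs [simp]: "finite (vpairs k n)"
  by (simp add: vpairs_def)

lemma finite_set_Pi_pmf:
  assumes "finite A" "\<And>x. x \<in> A \<Longrightarrow> finite (set_pmf (p x))"
  shows "finite (set_pmf (Pi_pmf A d p))"
  using assms by (simp add: set_Pi_pmf finite_PiE_dflt)

lemma finite_set_Pi_pmf_bool [simp]:
  fixes p :: "'a \<Rightarrow> bool pmf"
  shows "finite A \<Longrightarrow> finite (set_pmf (Pi_pmf A d p))"
  by (rule finite_set_Pi_pmf) auto

lemma finite_set_B_null [simp]: "finite (set_pmf (B_null k n p))"
  by (simp add: B_null_def)

lemma finite_set_B_planted [simp]: "finite (set_pmf (B_planted k n l p))"
  by (auto simp: B_planted_def)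

text \<open>For \<open>0 < p < 1\<close> the null model charges every graph without edges outside
  \<open>vpairs k n\<close>. This yields the absolute continuity needed for a density.\<close>

lemma set_B_planted_subset:
  assumes "0 < p" "p < 1"
  shows "set_pmf (B_planted k n l p) \<subseteq> set_pmf (B_null k n p)"
  using assms by (auto simp: B_planted_def B_null_def set_Pi_pmf PiE_dflt_def)

text \<open>Change of measure: from here on the likelihood ratio enters only through planted
  expectations.\<close>

lemma l2_inner_likelihood_ratio:
  assumes "0 < p" "p < 1"
  shows "l2_inner (B_null k n p) (likelihood_ratio k n l p) h =
           measure_pmf.expectation (B_planted k n l p) h"
proof -
  let ?M = "measure_pmf (B_null k n p)" and ?N = "measure_pmf (B_planted k n l p)"
  have ac: "absolutely_continuous ?M ?N"
    using set_B_planted_subset[OF assms, of k n l]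
    by (auto simp: absolutely_continuous_def null_sets_def
        measure_pmf.emeasure_eq_measure measure_pmf_zero_iff)
  show ?thesis
    unfolding l2_inner_def likelihood_ratio_def
    by (rule measure_pmf.RN_deriv_integral[symmetric])
       (use ac in \<open>auto intro: prob_space_imp_sigma_finite measure_pmf.prob_space_axioms\<close>)
qed

section \<open>Inner products and uniqueness of projections\<close>

lemma l2_inner_diff_left:
  assumes "finite (set_pmf M)"
  shows "l2_inner M (\<lambda>x. f x - g x) h = l2_inner M f h - l2_inner M g h"
  unfolding l2_inner_def left_diff_distrib
  using assms by (intro Bochner_Integration.integral_diff integrable_measure_pmf_finite) 

lemma l2_inner_commute: "l2_inner M f g = l2_inner M g f"
  by (simp add: l2_inner_def mult.commute)

lemma l2_inner_sum_left:
  assumes "finite (set_pmf M)"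
  shows "l2_inner M (\<lambda>x. \<Sum>i\<in>I. c i * f i x) h = (\<Sum>i\<in>I. c i * l2_inner M (f i) h)"
  using assms
  by (simp add: l2_inner_def sum_distrib_right mult.assoc integrable_measure_pmf_finite)

lemma l2_inner_sum_right:
  assumes "finite (set_pmf M)"
  shows "l2_inner M h (\<lambda>x. \<Sum>i\<in>I. c i * f i x) = (\<Sum>i\<in>I. c i * l2_inner M h (f i))"
  using l2_inner_sum_left[OF assms] by (simp add: l2_inner_commute[of M h])

text \<open>Both projections lie in \<open>W\<close> and have the same inner products with
  \<open>W\<close> as \<open>f\<close>, so <g,g> = <g,g'> = <g',g'>. An explicit projection can thus
  replace the one picked by \<open>SOME\<close>.\<close>

lemma l2_norm_orth_proj_unique:
  assumes fin: "finite (set_pmf M)" and g: "is_orth_proj M W f g" and g': "is_orth_proj M W f g'"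
  shows "l2_norm M g = l2_norm M g'"
proof -
  have "l2_inner M f h = l2_inner M g h" "l2_inner M f h = l2_inner M g' h" if "h \<in> W" for h
    using g g' that fin unfolding is_orth_proj_def by (auto simp: l2_inner_diff_left)
  with g g' have "l2_inner M g g = l2_inner M g' g'"
    unfolding is_orth_proj_def by (metis l2_inner_commute)
  then show ?thesis by (simp add: l2_norm_def)
qed

text \<open>The p-biased Fourier character of \<open>T\<close>: each factor is an edge indicator
  standardised to mean 0 and variance 1 under the null model.\<close>

definition fchar :: "real \<Rightarrow> (nat \<times> nat) set \<Rightarrow> bigraph \<Rightarrow> real" where
  "fchar p T H = (\<Prod>e\<in>T. (of_bool (H e) - p) / sqrt (p * (1 - p)))"

lemma prod_restrict_subset:
  assumes "finite A" "T \<subseteq> A"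
  shows "(\<Prod>e\<in>T. f e) = (\<Prod>e\<in>A. if e \<in> T then f e else 1)"
  using assms by (simp add: prod.If_cases Int_absorb1)

lemma fchar_orthonormal:
  assumes p: "0 < p" "p < 1" and "T \<subseteq> vpairs k n" "R \<subseteq> vpairs k n"
  shows "l2_inner (B_null k n p) (fchar p T) (fchar p R) = of_bool (T = R)"
proof -
  let ?x = "\<lambda>b. (of_bool b - p) / sqrt (p * (1 - p))"
  let ?f = "\<lambda>e b. (if e \<in> T then ?x b else 1) * (if e \<in> R then ?x b else 1)"
  have "l2_inner (B_null k n p) (fchar p T) (fchar p R) =
          measure_pmf.expectation (B_null k n p) (\<lambda>H. \<Prod>e\<in>vpairs k n. ?f e (H e))"
    unfolding l2_inner_def fchar_def prod_restrict_subset[OF finite_vpairs assms(3)]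
      prod_restrict_subset[OF finite_vpairs assms(4)] prod.distrib ..
  also have "\<dots> = (\<Prod>e\<in>vpairs k n. measure_pmf.expectation (bernoulli_pmf p) (?f e))"
    unfolding B_null_def by (rule expectation_prod_Pi_pmf_finite) auto
  \<comment> \<open>An edge in both sets contributes the variance 1, an edge in just one the mean 0,
    any other edge the factor 1.\<close>
  also have "\<dots> = (\<Prod>e\<in>vpairs k n. of_bool (e \<in> T \<longleftrightarrow> e \<in> R))"
  proof (intro prod.cong refl)
    fix e assume "e \<in> vpairs k n"
    have "p * (1 - p) > 0" using p by simp
    then have s: "sqrt (p * (1 - p)) * sqrt (p * (1 - p)) = p * (1 - p)" "sqrt (p * (1 - p)) \<noteq> 0"
      using p by auto
    show "measure_pmf.expectation (bernoulli_pmf p) (?f e) = of_bool (e \<in> T \<longleftrightarrow> e \<in> R)"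
      using p s by (auto simp: field_simps)
  qed
  also have "\<dots> = of_bool (T = R)"
  proof (cases "T = R")
    case False
    then obtain e where "e \<in> vpairs k n" "(e \<in> T) \<noteq> (e \<in> R)" using assms by blast
    then show ?thesis using False by (auto intro!: prod_zero)
  qed simp
  finally show ?thesis .
qed

section \<open>Fourier expansion of the projected likelihood ratio\<close>

text \<open>Each single exponent is at most \<open>D\<close>. Finiteness matters because a sum over
  an infinite index set is 0 by convention.\<close>

lemma finite_edge_exponents [simp]: "finite (edge_exponents k n D)"
proof -
  have "edge_exponents k n D \<subseteq> {m. \<forall>e. (e \<in> vpairs k n \<longrightarrow> m e \<in> {..D}) \<and> (e \<notin> vpairs k n \<longrightarrow> m e = 0)}"
  proof safe
    fix m e assume m: "m \<in> edge_exponents k n D" and e: "e \<in> vpairs k n"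
    have "m e \<le> sum m (vpairs k n)" using e by (intro member_le_sum) auto
    with m show "m e \<le> D" by (simp add: edge_exponents_def)
  qed (auto simp: edge_exponents_def)
  then show ?thesis
    by (rule finite_subset) (intro finite_set_of_finite_funs, auto)
qed

section \<open>Edge polynomials and the characters\<close>

lemma edge_polys_add: "f \<in> edge_polys k n D \<Longrightarrow> g \<in> edge_polys k n D \<Longrightarrow> (\<lambda>H. f H + g H) \<in> edge_polys k n D"
  unfolding edge_polys_def
proof clarsimp
  fix c c' assume 1: "\<forall>H. f H = (\<Sum>m\<in>edge_exponents k n D. c m * (\<Prod>e\<in>vpairs k n. of_bool (H e) ^ m e))"
    and 2: "\<forall>H. g H = (\<Sum>m\<in>edge_exponents k n D. c' m * (\<Prod>e\<in>vpairs k n. of_bool (H e) ^ m e))"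
  show "\<exists>d. \<forall>H. (\<Sum>m\<in>edge_exponents k n D. c m * (\<Prod>e\<in>vpairs k n. of_bool (H e) ^ m e)) +
     (\<Sum>m\<in>edge_exponents k n D. c' m * (\<Prod>e\<in>vpairs k n. of_bool (H e) ^ m e)) =
     (\<Sum>m\<in>edge_exponents k n D. d m * (\<Prod>e\<in>vpairs k n. of_bool (H e) ^ m e))"
    by (rule exI[of _ "\<lambda>m. c m + c' m"]) (simp add: sum.distrib distrib_right)
qed

lemma edge_polys_scale: "f \<in> edge_polys k n D \<Longrightarrow> (\<lambda>H. a * f H) \<in> edge_polys k n D"
  unfolding edge_polys_def
proof clarsimp
  fix c
  show "\<exists>d. \<forall>H. a * (\<Sum>m\<in>edge_exponents k n D. c m * (\<Prod>e\<in>vpairs k n. of_bool (H e) ^ m e)) =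
     (\<Sum>m\<in>edge_exponents k n D. d m * (\<Prod>e\<in>vpairs k n. of_bool (H e) ^ m e))"
    by (rule exI[of _ "\<lambda>m. a * c m"]) (simp add: sum_distrib_left mult.assoc)
qed

lemma edge_polys_sum:
  assumes "\<And>i. i \<in> I \<Longrightarrow> f i \<in> edge_polys k n D"
  shows "(\<lambda>H. \<Sum>i\<in>I. a i * f i H) \<in> edge_polys k n D"
  using assms
proof (induction I rule: infinite_finite_induct)
  case (insert i I)
  then show ?case by (simp add: edge_polys_add edge_polys_scale)
qed (auto simp: edge_polys_def intro!: exI[of _ "\<lambda>_. 0"])

lemma edge_monomial_in_edge_polys:
  assumes R: "R \<subseteq> vpairs k n" "card R \<le> D"
  shows "(\<lambda>H. \<Prod>e\<in>R. of_bool (H e)) \<in> edge_polys k n D"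
proof -
  let ?m = "\<lambda>e. of_bool (e \<in> R) :: nat"
  have "?m \<in> edge_exponents k n D"
    using R by (auto simp: edge_exponents_def Int_absorb1 sum.If_cases of_bool_def)
  moreover have "(\<Prod>e\<in>R. of_bool (H e)) = (\<Prod>e\<in>vpairs k n. (of_bool (H e) :: real) ^ ?m e)" for H :: bigraph
    unfolding prod_restrict_subset[OF finite_vpairs R(1)] by (intro prod.cong) auto
  \<comment> \<open>The coefficients are concentrated on the 0/1 exponent vector of
    \<open>R\<close>.\<close>
  ultimately show ?thesis
    unfolding edge_polys_def mem_Collect_eq
    by (intro exI[of _ "\<lambda>m. of_bool (m = ?m)"]) simp
qed

text \<open>Expanding the product of differences leaves multilinear monomials on subsets of
  \<open>T\<close>.\<close>

lemma fchar_in_edge_polys: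
  assumes T: "T \<subseteq> vpairs k n" "card T \<le> D"
  shows "fchar p T \<in> edge_polys k n D"
proof -
  have fin: "finite T" using T(1) finite_vpairs by (rule finite_subset)
  let ?s = "sqrt (p * (1 - p))"
  have eq: "fchar p T H = (\<Sum>R\<in>Pow T. ((1 / ?s ^ card T) * (\<Prod>e\<in>T-R. - p)) * (\<Prod>e\<in>R. of_bool (H e)))" for H
  proof -
    have "fchar p T H = (\<Prod>e\<in>T. of_bool (H e) + - p) / ?s ^ card T"
      by (simp add: fchar_def prod_dividef)
    then show ?thesis
      unfolding prod_add[OF fin] by (simp add: sum_divide_distrib mult_ac)
  qed
  show ?thesis
    unfolding eq[abs_def]
    by (intro edge_polys_sum edge_monomial_in_edge_polys)
       (use T fin in \<open>auto intro: le_trans[OF card_mono]\<close>)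
qed

text \<open>The converse expansion: each indicator is its standardisation times
  \<open>sqrt (p * (1 - p))\<close>, plus \<open>p\<close>.\<close>

lemma edge_monomial_eq_sum_fchar:
  assumes p: "0 < p" "p < 1" and fin: "finite R"
  shows "(\<Prod>e\<in>R. of_bool (H e)) =
           (\<Sum>T\<in>Pow R. (sqrt (p * (1 - p)) ^ card T * p ^ card (R - T)) * fchar p T H)"
proof -
  let ?s = "sqrt (p * (1 - p))"
  have s: "?s > 0" using p by simp
  have "(\<Prod>e\<in>R. of_bool (H e)) = (\<Prod>e\<in>R. ?s * ((of_bool (H e) - p) / ?s) + p)"
    using s by (intro prod.cong) auto
  then show ?thesis
    unfolding prod_add[OF fin] fchar_def by (simp only: prod.distrib prod_constant mult_ac)
qed

text \<open>For \<open>0 < p < 1\<close>, change of measure makes this the Fourier coefficient of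
  the likelihood ratio at \<open>T\<close>.\<close>

definition planted_coeff :: "nat \<Rightarrow> nat \<Rightarrow> nat \<Rightarrow> real \<Rightarrow> (nat \<times> nat) set \<Rightarrow> real" where
  "planted_coeff k n l p T = measure_pmf.expectation (B_planted k n l p) (fchar p T)"

definition edge_sets :: "nat \<Rightarrow> nat \<Rightarrow> nat \<Rightarrow> (nat \<times> nat) set set" where
  "edge_sets k n D = {T. T \<subseteq> vpairs k n \<and> card T \<le> D}"

lemma finite_edge_sets [simp]: "finite (edge_sets k n D)"
  by (rule finite_subset[of _ "Pow (vpairs k n)"]) (auto simp: edge_sets_def)

text \<open>By orthonormality the residual is orthogonal to every character with at most
  \<open>D\<close> edges, and all monomials of degree at most \<open>D\<close> are combinations of
  these.\<close>

lemma is_orth_proj_fourier: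
  assumes p: "0 < p" "p < 1"
  shows "is_orth_proj (B_null k n p) (edge_polys k n D) (likelihood_ratio k n l p)
           (\<lambda>H. \<Sum>T\<in>edge_sets k n D. planted_coeff k n l p T * fchar p T H)"
proof -
  let ?M = "B_null k n p" and ?L = "likelihood_ratio k n l p"
  let ?g = "\<lambda>H. \<Sum>T\<in>edge_sets k n D. planted_coeff k n l p T * fchar p T H"
  have fin: "finite (set_pmf ?M)" by simp
  have g: "?g \<in> edge_polys k n D"
    by (intro edge_polys_sum fchar_in_edge_polys) (auto simp: edge_sets_def)
  have 1: "l2_inner ?M (\<lambda>H. ?L H - ?g H) (fchar p T) = 0" if T: "T \<in> edge_sets k n D" for T
  proof -
    have "l2_inner ?M ?g (fchar p T) = (\<Sum>R\<in>edge_sets k n D. planted_coeff k n l p R * of_bool (R = T))"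
      unfolding l2_inner_sum_left[OF fin]
      using T p by (intro sum.cong refl) (auto simp: fchar_orthonormal edge_sets_def)
    also have "\<dots> = l2_inner ?M ?L (fchar p T)"
      using T by (simp add: l2_inner_likelihood_ratio[OF p] planted_coeff_def)
    finally show ?thesis by (simp add: l2_inner_diff_left)
  qed
  have 2: "l2_inner ?M (\<lambda>H. ?L H - ?g H) (\<lambda>H. \<Prod>e\<in>vpairs k n. of_bool (H e) ^ m e) = 0"
    if m: "m \<in> edge_exponents k n D" for m
  proof -
    \<comment> \<open>Indicators are idempotent, so only the support of the exponent vector matters;
      it has at most \<open>D\<close> elements because positive exponents are at least 1.\<close>
    define R where "R = {e \<in> vpairs k n. m e > 0}"
    have R: "R \<subseteq> vpairs k n" by (auto simp: R_def)
    have finR: "finite R" by (simp add: R_def)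
    have "card R = (\<Sum>e\<in>R. 1)" by simp
    also have "\<dots> \<le> (\<Sum>e\<in>R. m e)" by (intro sum_mono) (auto simp: R_def)
    also have "\<dots> \<le> (\<Sum>e\<in>vpairs k n. m e)" by (intro sum_mono2 R) auto
    also have "\<dots> \<le> D" using m by (simp add: edge_exponents_def)
    finally have cR: "card R \<le> D" .
    have "(\<Prod>e\<in>vpairs k n. of_bool (H e) ^ m e) = (\<Prod>e\<in>R. of_bool (H e) :: real)" for H :: bigraph
      unfolding prod_restrict_subset[OF finite_vpairs R] by (intro prod.cong) (auto simp: R_def)
    then have *: "(\<lambda>H. \<Prod>e\<in>vpairs k n. of_bool (H e) ^ m e) =
         (\<lambda>H. \<Sum>T\<in>Pow R. (sqrt (p * (1 - p)) ^ card T * p ^ card (R - T)) * fchar p T H)"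
      using edge_monomial_eq_sum_fchar[OF p finR] by presburger
    show ?thesis
      unfolding * l2_inner_sum_right[OF fin]
    proof (intro sum.neutral ballI)
      fix T assume "T \<in> Pow R"
      then have "T \<in> edge_sets k n D"
        using R cR card_mono[OF finR, of T] by (auto simp: edge_sets_def)
      then show "sqrt (p * (1 - p)) ^ card T * p ^ card (R - T) * l2_inner ?M (\<lambda>H. ?L H - ?g H) (fchar p T) = 0"
        by (simp only: 1 mult_zero_right)
    qed
  qed
  have "l2_inner ?M (\<lambda>H. ?L H - ?g H) h = 0" if h: "h \<in> edge_polys k n D" for h
  proof -
    obtain c where h: "h = (\<lambda>H. \<Sum>m\<in>edge_exponents k n D. c m * (\<Prod>e\<in>vpairs k n. of_bool (H e) ^ m e))"
      using h unfolding edge_polys_def by (auto simp: fun_eq_iff)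
    show ?thesis unfolding h l2_inner_sum_right[OF fin]
      by (intro sum.neutral ballI) (simp only: 2 mult_zero_right)
  qed
  then show ?thesis unfolding is_orth_proj_def using g by blast
qed

text \<open>Parseval, after the projection chosen by \<open>SOME\<close> is exchanged for the
  Fourier sum.\<close>

lemma low_degree_LR_norm_eq:
  assumes p: "0 < p" "p < 1"
  shows "low_degree_LR_norm D k n l p = sqrt (\<Sum>T\<in>edge_sets k n D. (planted_coeff k n l p T)\<^sup>2)"
proof -
  let ?M = "B_null k n p" and ?W = "edge_polys k n D" and ?L = "likelihood_ratio k n l p"
  let ?c = "planted_coeff k n l p"
  let ?g = "\<lambda>H. \<Sum>T\<in>edge_sets k n D. ?c T * fchar p T H"
  have fin: "finite (set_pmf ?M)" by simp
  note g = is_orth_proj_fourier[OF p, of k n D l]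
  then have "is_orth_proj ?M ?W ?L (low_degree_LR D k n l p)"
    unfolding low_degree_LR_def by (rule someI[where P = "is_orth_proj ?M ?W ?L"])
  then have "low_degree_LR_norm D k n l p = l2_norm ?M ?g"
    unfolding low_degree_LR_norm_def using g by (rule l2_norm_orth_proj_unique[OF fin])
  also have "l2_inner ?M ?g ?g = (\<Sum>T\<in>edge_sets k n D. ?c T * (\<Sum>R\<in>edge_sets k n D. ?c R * of_bool (T = R)))"
    unfolding l2_inner_sum_left[OF fin] l2_inner_sum_right[OF fin]
    using p by (intro sum.cong refl arg_cong2[where f = "(*)"])
       (auto simp: fchar_orthonormal edge_sets_def)
  then have "l2_norm ?M ?g = sqrt (\<Sum>T\<in>edge_sets k n D. (?c T)\<^sup>2)"
    by (simp add: l2_norm_def power2_eq_square)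
  finally show ?thesis .
qed

section \<open>Fourier coefficients of the planted distribution\<close>

lemma expectation_bind_pmf_finite:
  fixes h :: "'b \<Rightarrow> real"
  assumes "finite (set_pmf M)" "\<And>x. finite (set_pmf (f x))"
  shows "measure_pmf.expectation (M \<bind> f) h =
           measure_pmf.expectation M (\<lambda>x. measure_pmf.expectation (f x) h)"
  using assms
  by (simp add: pmf_expectation_bind[of "set_pmf M"] integral_measure_pmf_real[of "set_pmf M"] mult.commute)

definition right_degree :: "(nat \<times> nat) set \<Rightarrow> nat \<Rightarrow> nat" where
  "right_degree T v = card {e \<in> T. snd e = v}"

text \<open>The planted mean of a standardised edge at a left vertex in \<open>S\<close>;
  \<open>b\<close> tells whether the right vertex is in \<open>P\<close>, an event of probability
  \<open>a\<close>.\<close>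

definition bias :: "real \<Rightarrow> real \<Rightarrow> bool \<Rightarrow> real" where
  "bias p a b = sqrt ((1 - p) / p) * (if b then 1 else - (a / (1 - a)))"

definition bias_moment :: "real \<Rightarrow> real \<Rightarrow> nat \<Rightarrow> real" where
  "bias_moment p a d = a * bias p a True ^ d + (1 - a) * bias p a False ^ d"

lemma prod_of_bool:
  "finite A \<Longrightarrow> (\<Prod>x\<in>A. of_bool (P x)) = (of_bool (\<forall>x\<in>A. P x) :: real)"
  by (induction A rule: finite_induct) auto

lemma expectation_planted_edge:
  assumes p: "0 < p" "p < 1" and n: "0 < n" and ok: "model_ok k n l p"
  shows "measure_pmf.expectation (bernoulli_pmf (planted_edge_prob k n l p inS inP))
           (\<lambda>b. (of_bool b - p) / sqrt (p * (1 - p))) =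
           of_bool inS * bias p ((real k - real l) / real n) inP"
proof -
  let ?s = "sqrt (p * (1 - p))"
  define a where "a = (real k - real l) / real n"
  have kl: "real k - real l = real n * a" using n by (simp add: a_def)
  have a: "0 \<le> a" "a \<le> p"
    using ok n by (auto simp: a_def model_ok_def field_simps)
  \<comment> \<open>Dividing numerator and denominator by \<open>n\<close> gives this form of the
    edge probability. As \<open>a \<le> p\<close>, it lies in [0, 1] and
    \<open>bernoulli_pmf\<close> does not clip it.\<close>
  define r where "r = (p - a) / (1 - a)"
  have r: "(real n * p - (real k - real l)) / (real n - (real k - real l)) = r"
    unfolding kl r_def using n a p by (simp add: field_simps)
  have r01: "0 \<le> r" "r \<le> 1" using a p by (auto simp: r_def)
  have pe: "0 \<le> planted_edge_prob k n l p inS inP" "planted_edge_prob k n l p inS inP \<le> 1"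
    using r01 p by (auto simp: planted_edge_prob_def r)
  have "(1 - p) / ?s = ((1 - p) / sqrt (1 - p)) / sqrt p"
    by (simp add: real_sqrt_mult mult.commute)
  then have s: "(1 - p) / ?s = sqrt ((1 - p) / p)"
    using p by (simp add: real_div_sqrt real_sqrt_divide)
  have E: "measure_pmf.expectation (bernoulli_pmf x) (\<lambda>b. (of_bool b - p) / ?s) = (x - p) / ?s"
    if "0 \<le> x" "x \<le> 1" for x
    using that by (simp add: diff_divide_distrib algebra_simps)
  have "r - p = (1 - p) * - (a / (1 - a))"
    using a p by (simp add: r_def field_simps)
  then have "(r - p) / ?s = sqrt ((1 - p) / p) * - (a / (1 - a))"
    by (metis s times_divide_eq_left)
  then show ?thesis
    unfolding E[OF pe] a_def[symmetric]
    by (auto simp: planted_edge_prob_def r bias_def s)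
qed

lemma planted_coeff_eq:
  assumes p: "0 < p" "p < 1" and k: "0 < k" and n: "0 < n" and ok: "model_ok k n l p"
    and T: "T \<subseteq> vpairs k n"
  defines "a \<equiv> (real k - real l) / real n"
  shows "planted_coeff k n l p T =
           (real l / real k) ^ card (fst ` T) * (\<Prod>v\<in>snd ` T. bias_moment p a (right_degree T v))"
proof -
  have finT: "finite T" using T finite_vpairs by (rule finite_subset)
  have sub: "fst ` T \<subseteq> {..<k}" "snd ` T \<subseteq> {..<n}" using T by (auto simp: vpairs_def)
  have "0 \<le> a" "a \<le> p"
    using ok n by (auto simp: a_def model_ok_def field_simps)
  then have a: "0 \<le> a" "a \<le> 1" using p by auto
  have s: "0 \<le> real l / real k" "real l / real k \<le> 1" using k ok by (auto simp: model_ok_def)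
  let ?X = "\<lambda>b. (of_bool b - p) / sqrt (p * (1 - p))"
  let ?Q = "\<lambda>S P. Pi_pmf (vpairs k n) False (\<lambda>(u, v). bernoulli_pmf (planted_edge_prob k n l p (S u) (P v)))"
  have cond: "measure_pmf.expectation (?Q S P) (fchar p T) =
      (\<Prod>u\<in>fst ` T. of_bool (S u)) * (\<Prod>v\<in>snd ` T. bias p a (P v) ^ right_degree T v)" for S P
  proof -
    have "measure_pmf.expectation (?Q S P) (fchar p T) =
        measure_pmf.expectation (?Q S P) (\<lambda>H. \<Prod>e\<in>vpairs k n. (\<lambda>b. if e \<in> T then ?X b else 1) (H e))"
      unfolding fchar_def prod_restrict_subset[OF finite_vpairs T] ..
    also have "\<dots> = (\<Prod>e\<in>vpairs k n. measure_pmf.expectation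
        (case e of (u, v) \<Rightarrow> bernoulli_pmf (planted_edge_prob k n l p (S u) (P v))) (\<lambda>b. if e \<in> T then ?X b else 1))"
      by (rule expectation_prod_Pi_pmf_finite) auto
    also have "\<dots> = (\<Prod>e\<in>T. of_bool (S (fst e)) * bias p a (P (snd e)))"
      unfolding prod_restrict_subset[OF finite_vpairs T] a_def
      by (intro prod.cong refl) (auto simp: expectation_planted_edge[OF p n ok]
            simp del: integral_divide_zero integral_bernoulli_pmf)
    also have "\<dots> = (\<Prod>e\<in>T. of_bool (S (fst e))) * (\<Prod>e\<in>T. bias p a (P (snd e)))"
      by (rule prod.distrib)
    \<comment> \<open>Idempotence again: a left vertex counts once, whatever its degree.\<close>
    also have "(\<Prod>e\<in>T. of_bool (S (fst e))) = (\<Prod>u\<in>fst ` T. of_bool (S u) :: real)"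
      using finT by (simp add: prod_of_bool)
    \<comment> \<open>By contrast, the edges at a right vertex accumulate to a power of its
      bias.\<close>
    also have "(\<Prod>e\<in>T. bias p a (P (snd e))) =
        (\<Prod>v\<in>snd ` T. \<Prod>e\<in>{e. e \<in> T \<and> snd e = v}. bias p a (P (snd e)))"
      using finT by (rule prod.image_gen)
    also have "\<dots> = (\<Prod>v\<in>snd ` T. bias p a (P v) ^ right_degree T v)"
      by (intro prod.cong refl) (simp add: right_degree_def)
    finally show ?thesis .
  qed
  let ?S = "Pi_pmf {..<k} False (\<lambda>_. bernoulli_pmf (real l / real k))"
  let ?P = "Pi_pmf {..<n} False (\<lambda>_. bernoulli_pmf a)"
  have "planted_coeff k n l p T = measure_pmf.expectation ?S (\<lambda>S. measure_pmf.expectation ?P (\<lambda>P.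
      measure_pmf.expectation (?Q S P) (fchar p T)))"
    unfolding planted_coeff_def B_planted_def a_def
    by (simp add: expectation_bind_pmf_finite)
  \<comment> \<open>The conditional mean splits into a factor in \<open>S\<close> and a factor in
    \<open>P\<close>, which are drawn independently.\<close>
  also have "\<dots> = measure_pmf.expectation ?S (\<lambda>S. \<Prod>u\<in>fst ` T. of_bool (S u)) *
      measure_pmf.expectation ?P (\<lambda>P. \<Prod>v\<in>snd ` T. bias p a (P v) ^ right_degree T v)"
    by (simp add: cond)
  also have "measure_pmf.expectation ?S (\<lambda>S. \<Prod>u\<in>fst ` T. of_bool (S u) :: real) =
      measure_pmf.expectation ?S (\<lambda>S. \<Prod>u\<in>{..<k}. (\<lambda>b. if u \<in> fst ` T then of_bool b else 1) (S u))"
    unfolding prod_restrict_subset[OF finite_lessThan sub(1)] ..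
  also have "\<dots> = (\<Prod>u\<in>{..<k}. measure_pmf.expectation (bernoulli_pmf (real l / real k))
       (\<lambda>b. if u \<in> fst ` T then of_bool b else 1))"
    by (rule expectation_prod_Pi_pmf_finite) auto
  also have "\<dots> = (\<Prod>u\<in>fst ` T. real l / real k)"
    unfolding prod_restrict_subset[OF finite_lessThan sub(1)]
    using s by (intro prod.cong refl) (auto simp del: of_nat_le_iff)
  also have "measure_pmf.expectation ?P (\<lambda>P. \<Prod>v\<in>snd ` T. bias p a (P v) ^ right_degree T v) =
      measure_pmf.expectation ?P (\<lambda>P. \<Prod>v\<in>{..<n}. (\<lambda>b. if v \<in> snd ` T then bias p a b ^ right_degree T v else 1) (P v))"
    unfolding prod_restrict_subset[OF finite_lessThan sub(2)] ..
  also have "\<dots> = (\<Prod>v\<in>{..<n}. measure_pmf.expectation (bernoulli_pmf a)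
       (\<lambda>b. if v \<in> snd ` T then bias p a b ^ right_degree T v else 1))"
    by (rule expectation_prod_Pi_pmf_finite) auto
  also have "\<dots> = (\<Prod>v\<in>snd ` T. bias_moment p a (right_degree T v))"
    unfolding prod_restrict_subset[OF finite_lessThan sub(2)]
    using a by (intro prod.cong refl) (auto simp: bias_moment_def mult.commute)
  finally show ?thesis by simp
qed

section \<open>Upper bound on the Fourier weight\<close>

text \<open>The calibration of the model: a right vertex of degree 1 annihilates the whole
  coefficient.\<close>

lemma bias_moment_1: "a < 1 \<Longrightarrow> bias_moment p a 1 = 0"
  by (simp add: bias_moment_def bias_def)

text \<open>With t = a / (1 - a) one has (1 - a) t = a, so a + (1 - a) t^2 = a + a t = t.\<close>

lemma bias_moment_2:
  assumes "0 < p" "p < 1" "a < 1"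
  shows "bias_moment p a 2 = (1 - p) / p * (a / (1 - a))"
proof -
  define w where "w = sqrt ((1 - p) / p)"
  define t where "t = a / (1 - a)"
  have w2: "w\<^sup>2 = (1 - p) / p" using assms by (simp add: w_def)
  have "bias_moment p a 2 = a * w\<^sup>2 + (1 - a) * (w * - t)\<^sup>2"
    by (simp add: bias_moment_def bias_def w_def t_def)
  also have "\<dots> = w\<^sup>2 * (a + (1 - a) * t\<^sup>2)"
    by (simp add: power_mult_distrib algebra_simps)
  also have "a + (1 - a) * t\<^sup>2 = a + ((1 - a) * t) * t"
    by (simp add: power2_eq_square)
  also have t: "(1 - a) * t = a" using assms by (simp add: t_def)
  also have "a + a * t = t" using t by (simp add: algebra_simps)
  finally show ?thesis by (simp add: w2 t_def)
qed

text \<open>For d \<ge> 2, w \<le> 1 gives w^d \<le> w^2 = (1 - p) / p \<le> 2 (1 - p), and (1 - a)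
  t^d = a t^(d-1) with t \<le> 1/\<delta>. The constant depends on \<delta> and \<open>D\<close>
  only.\<close>

lemma abs_bias_moment_le:
  assumes p: "1/2 \<le> p" "p < 1" and \<delta>: "0 < \<delta>" and a: "0 \<le> a" "a \<le> 1 - \<delta>"
    and d: "1 \<le> d" "d \<le> D"
  shows "\<bar>bias_moment p a d\<bar> \<le> 2 * (1 + (1 / \<delta>) ^ D) * (1 - p) * a"
proof (cases "d = 1")
  case True
  with p \<delta> a show ?thesis by (simp add: bias_moment_1[simplified])
next
  case False
  define w where "w = sqrt ((1 - p) / p)"
  define t where "t = a / (1 - a)"
  obtain e where d': "d = Suc e" "1 \<le> e" using d False by (cases d) auto
  have w: "0 \<le> w" "w \<le> 1" using p by (auto simp: w_def)
  have t: "0 \<le> t" "t \<le> 1 / \<delta>" "1 - a > 0" "(1 - a) * t = a"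
    using a \<delta> frac_le[of 1 a \<delta> "1 - a"] by (auto simp: t_def)
  have "w ^ d \<le> w ^ 2" using w d False by (intro power_decreasing) auto
  also have "\<dots> = (1 - p) / p" using p by (simp add: w_def)
  also have "\<dots> \<le> 2 * (1 - p)"
  proof -
    have "(1 - p) * 1 \<le> (1 - p) * (2 * p)" using p by (intro mult_left_mono) auto
    then show ?thesis using p by (simp add: field_simps)
  qed
  finally have wd: "w ^ d \<le> 2 * (1 - p)" .
  have "t ^ e \<le> (1 / \<delta>) ^ e" using t by (intro power_mono) auto
  also have "\<dots> \<le> (1 / \<delta>) ^ D"
    \<comment> \<open>The bounds on \<open>a\<close> force \<delta> \<le> 1, so the base 1/\<delta>
      is at least 1.\<close>
    using \<delta> a d d' by (intro power_increasing) auto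
  finally have te: "t ^ e \<le> (1 / \<delta>) ^ D" .
  have "\<bar>bias_moment p a d\<bar> \<le> \<bar>a * w ^ d\<bar> + \<bar>(1 - a) * (- t * w) ^ d\<bar>"
    unfolding bias_moment_def bias_def w_def t_def by (simp add: mult.commute abs_triangle_ineq)
  also have "\<bar>a * w ^ d\<bar> = a * w ^ d" using a w by simp
  also have "\<bar>(1 - a) * (- t * w) ^ d\<bar> = ((1 - a) * t) * t ^ e * w ^ d"
    using t w by (simp add: abs_mult power_abs power_mult_distrib d')
  also have "\<dots> = a * t ^ e * w ^ d" using t by simp
  also have "a * w ^ d + a * t ^ e * w ^ d = a * ((1 + t ^ e) * w ^ d)" by (simp add: algebra_simps)
  also have "\<dots> \<le> a * ((1 + (1 / \<delta>) ^ D) * (2 * (1 - p)))"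
    using a te wd t w \<delta> by (intro mult_left_mono mult_mono) auto
  finally show ?thesis by (simp add: algebra_simps)
qed

section \<open>Counting edge sets by their shadows\<close>

lemma sum_Pow_power_card:
  "finite U \<Longrightarrow> (\<Sum>A\<in>Pow U. x ^ card A) = (1 + x :: real) ^ card U"
  using prod_add[of U "\<lambda>_. x" "\<lambda>_. 1"] by (simp add: add.commute)

lemma one_plus_power_le_exp: "0 \<le> x \<Longrightarrow> (1 + x :: real) ^ m \<le> exp (real m * x)"
  unfolding exp_of_nat_mult by (intro power_mono exp_ge_add_one_self) auto

text \<open>
  An edge set with at most \<open>D\<close> edges is contained in \<open>A \<times> B\<close>, where its shadows \<open>A\<close> and \<open>B\<close> have at most
  \<open>D\<close> elements each, so at most \<open>2\<^bsup>D\<^sup>2\<^esup>\<close> edge sets share the same pair of shadows.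
\<close>

lemma sum_edge_sets_le:
  fixes x y :: real
  assumes x: "0 \<le> x" and y: "0 \<le> y"
  shows "(\<Sum>T\<in>edge_sets k n D - {{}}. x ^ card (fst ` T) * y ^ card (snd ` T)) \<le>
           2 ^ (D * D) * ((exp (real k * x) - 1) * exp (real n * y))"
proof -
  let ?G = "edge_sets k n D - {{}}"
  \<comment> \<open>A nonempty edge set has a nonempty left shadow. Dropping the empty one produces
    the \<open>- 1\<close> that makes the bound small when \<open>k * x\<close> is small.\<close>
  let ?Z = "(Pow {..<k} - {{}}) \<times> Pow {..<n}"
  let ?h = "\<lambda>T. (fst ` T, snd ` T)"
  have fin: "finite T" if "T \<in> ?G" for T
    using that by (auto simp: edge_sets_def intro: finite_subset[OF _ finite_vpairs])
  have hG: "?h ` ?G \<subseteq> ?Z" by (auto simp: edge_sets_def vpairs_def)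
  have card_fibre: "card {T \<in> ?G. ?h T = z} \<le> 2 ^ (D * D)" for z
  proof (cases "{T \<in> ?G. ?h T = z} = {}")
    case True
    show ?thesis unfolding True by simp
  next
    case False
    then obtain T where T: "T \<in> ?G" "z = ?h T" by blast
    have "card (fst ` T) \<le> D" "card (snd ` T) \<le> D"
      using card_image_le[OF fin[OF T(1)]] T(1) by (auto simp: edge_sets_def intro: le_trans)
    then have le: "card (fst ` T \<times> snd ` T) \<le> D * D"
      by (simp add: card_cartesian_product mult_le_mono)
    have "card {T \<in> ?G. ?h T = z} \<le> card (Pow (fst ` T \<times> snd ` T))"
    proof (intro card_mono subsetI PowI)
      fix T' e assume "T' \<in> {T \<in> ?G. ?h T = z}" "e \<in> T'"
      then have "fst ` T' = fst ` T" "snd ` T' = snd ` T" "e \<in> T'" using T(2) by auto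
      then show "e \<in> fst ` T \<times> snd ` T" by (metis imageI mem_Times_iff)
    qed (use fin[OF T(1)] in auto)
    also have "\<dots> = 2 ^ card (fst ` T \<times> snd ` T)" using fin[OF T(1)] by (simp add: card_Pow)
    also have "\<dots> \<le> 2 ^ (D * D)" using le by (intro power_increasing) auto
    finally show ?thesis .
  qed
  define F where "F z = x ^ card (fst z) * y ^ card (snd z)" for z :: "nat set \<times> nat set"
  have F: "0 \<le> F z" for z using x y by (simp add: F_def)
  have "(\<Sum>T\<in>?G. x ^ card (fst ` T) * y ^ card (snd ` T)) = (\<Sum>T\<in>?G. F (?h T))"
    by (simp add: F_def)
  also have "\<dots> = (\<Sum>z\<in>?Z. \<Sum>T\<in>{T \<in> ?G. ?h T = z}. F (?h T))"
    by (rule sum.group[symmetric, OF _ _ hG]) simp_all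
  also have "\<dots> = (\<Sum>z\<in>?Z. real (card {T \<in> ?G. ?h T = z}) * F z)"
  proof (rule sum.cong[OF refl])
    fix z
    have "(\<Sum>T\<in>{T \<in> ?G. ?h T = z}. F (?h T)) = (\<Sum>T\<in>{T \<in> ?G. ?h T = z}. F z)"
      by (rule sum.cong[OF refl]) (simp only: mem_Collect_eq)
    then show "(\<Sum>T\<in>{T \<in> ?G. ?h T = z}. F (?h T)) = real (card {T \<in> ?G. ?h T = z}) * F z"
      by (simp only: sum_constant)
  qed
  also have "\<dots> \<le> (\<Sum>z\<in>?Z. 2 ^ (D * D) * F z)"
  proof (rule sum_mono, rule mult_right_mono[OF _ F])
    fix z
    have "real (card {T \<in> ?G. ?h T = z}) \<le> real (2 ^ (D * D))"
      using card_fibre[of z] by (simp only: of_nat_le_iff)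
    then show "real (card {T \<in> ?G. ?h T = z}) \<le> 2 ^ (D * D)"
      by simp
  qed
  also have "\<dots> = 2 ^ (D * D) * (\<Sum>z\<in>?Z. F z)"
    by (rule sum_distrib_left[symmetric])
  also have "(\<Sum>z\<in>?Z. F z) = (\<Sum>A\<in>Pow {..<k} - {{}}. x ^ card A) * (\<Sum>B\<in>Pow {..<n}. y ^ card B)"
    by (simp only: sum_product sum.cartesian_product F_def case_prod_unfold)
  also have "(\<Sum>A\<in>Pow {..<k} - {{}}. x ^ card A) = (1 + x) ^ k - 1"
    by (subst sum_diff1) (auto simp: sum_Pow_power_card)
  also have "(\<Sum>B\<in>Pow {..<n}. y ^ card B) = (1 + y) ^ n"
    by (simp add: sum_Pow_power_card)
  also have "2 ^ (D * D) * (((1 + x) ^ k - 1) * (1 + y) ^ n) \<le>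
      2 ^ (D * D) * ((exp (real k * x) - 1) * exp (real n * y))"
    using x y by (intro mult_left_mono mult_mono diff_right_mono one_plus_power_le_exp) auto
  finally show ?thesis .
qed

lemma planted_coeff_empty: "planted_coeff k n l p {} = 1"
  by (simp add: planted_coeff_def fchar_def[abs_def])

text \<open>The empty edge set contributes exactly 1. The margin \<delta> keeps \<open>a\<close>
  away from 1, so one constant \<open>K\<close> serves all moments in the remaining
  coefficients.\<close>

lemma low_degree_LR_norm_bounds:
  fixes D :: nat
  assumes p: "1/2 \<le> p" "p < 1" and k: "0 < k" and n: "0 < n" and ok: "model_ok k n l p"
    and \<delta>: "0 < \<delta>" "real k \<le> (1 - \<delta>) * real n"
  defines "K \<equiv> 2 * (1 + (1 / \<delta>) ^ D)"
  shows "1 \<le> (low_degree_LR_norm D k n l p)\<^sup>2"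
    and "(low_degree_LR_norm D k n l p)\<^sup>2 \<le> 1 + 2 ^ (D * D) *
      ((exp ((real l)\<^sup>2 / real k) - 1) * exp (K\<^sup>2 * (1 - p)\<^sup>2 * (real k)\<^sup>2 / real n))"
proof -
  define a where "a = (real k - real l) / real n"
  let ?c = "planted_coeff k n l p"
  let ?x = "(real l / real k)\<^sup>2" and ?y = "(K * (1 - p) * a)\<^sup>2"
  have p0: "0 < p" using p by simp
  have lk: "real l \<le> real k" using ok by (simp add: model_ok_def)
  have a: "0 \<le> a" "a \<le> real k / real n" "a \<le> 1 - \<delta>"
  proof -
    show "0 \<le> a" "a \<le> real k / real n" using lk n by (auto simp: a_def field_simps)
    have "real k / real n \<le> 1 - \<delta>" using \<delta> n by (simp add: field_simps)
    with \<open>a \<le> real k / real n\<close> show "a \<le> 1 - \<delta>" by simp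
  qed
  have K: "0 \<le> K" using \<delta> by (simp add: K_def)
  have sq: "(low_degree_LR_norm D k n l p)\<^sup>2 = (\<Sum>T\<in>edge_sets k n D. (?c T)\<^sup>2)"
    using low_degree_LR_norm_eq[OF p0 p(2)] by (simp add: sum_nonneg)
  have "{} \<in> edge_sets k n D" by (simp add: edge_sets_def)
  then have split: "(\<Sum>T\<in>edge_sets k n D. (?c T)\<^sup>2) = 1 + (\<Sum>T\<in>edge_sets k n D - {{}}. (?c T)\<^sup>2)"
    by (simp add: sum.remove planted_coeff_empty)
  show "1 \<le> (low_degree_LR_norm D k n l p)\<^sup>2"
    unfolding sq split by (simp add: sum_nonneg)
  have c: "(?c T)\<^sup>2 \<le> ?x ^ card (fst ` T) * ?y ^ card (snd ` T)" if T: "T \<in> edge_sets k n D" for T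
  proof -
    have sub: "T \<subseteq> vpairs k n" and cT: "card T \<le> D" using T by (auto simp: edge_sets_def)
    have finT: "finite T" using sub finite_vpairs by (rule finite_subset)
    have "(bias_moment p a (right_degree T v))\<^sup>2 \<le> ?y" if v: "v \<in> snd ` T" for v
    proof -
      \<comment> \<open>Right vertices of \<open>T\<close> have degree between 1 and
        \<open>D\<close>, the range of the moment bound.\<close>
      have "{e \<in> T. snd e = v} \<noteq> {}" using v by auto
      then have "1 \<le> right_degree T v"
        unfolding right_degree_def using finT by (simp add: Suc_le_eq card_gt_0_iff)
      moreover have "right_degree T v \<le> D"
        unfolding right_degree_def using card_mono[OF finT, of "{e \<in> T. snd e = v}"] cT by auto
      ultimately have "\<bar>bias_moment p a (right_degree T v)\<bar> \<le> K * (1 - p) * a"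
        unfolding K_def by (intro abs_bias_moment_le p \<delta> a)
      then show ?thesis using K p a by (subst power2_le_iff_abs_le) auto
    qed
    then have "(\<Prod>v\<in>snd ` T. (bias_moment p a (right_degree T v))\<^sup>2) \<le> ?y ^ card (snd ` T)"
      using prod_mono[of "snd ` T" "\<lambda>v. (bias_moment p a (right_degree T v))\<^sup>2" "\<lambda>_. ?y"] by simp
    moreover have "(?c T)\<^sup>2 = ?x ^ card (fst ` T) * (\<Prod>v\<in>snd ` T. (bias_moment p a (right_degree T v))\<^sup>2)"
      unfolding planted_coeff_eq[OF p0 p(2) k n ok sub, folded a_def] power_mult_distrib
      by (simp add: prod_power_distrib power_mult[symmetric] mult.commute)
    ultimately show ?thesis by (simp only: mult_left_mono zero_le_power zero_le_power2)
  qed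
  have "(\<Sum>T\<in>edge_sets k n D - {{}}. (?c T)\<^sup>2) \<le>
      (\<Sum>T\<in>edge_sets k n D - {{}}. ?x ^ card (fst ` T) * ?y ^ card (snd ` T))"
    by (intro sum_mono c) simp
  also have "\<dots> \<le> 2 ^ (D * D) * ((exp (real k * ?x) - 1) * exp (real n * ?y))"
    by (intro sum_edge_sets_le) simp_all
  also have "real k * ?x = (real l)\<^sup>2 / real k" using k by (simp add: power2_eq_square)
  also have "2 ^ (D * D) * ((exp ((real l)\<^sup>2 / real k) - 1) * exp (real n * ?y)) \<le>
      2 ^ (D * D) * ((exp ((real l)\<^sup>2 / real k) - 1) * exp (K\<^sup>2 * (1 - p)\<^sup>2 * (real k)\<^sup>2 / real n))"
  proof -
    have "a\<^sup>2 \<le> (real k / real n)\<^sup>2" using a by (intro power_mono)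
    then have "real n * ((K * (1 - p))\<^sup>2 * a\<^sup>2) \<le> real n * ((K * (1 - p))\<^sup>2 * (real k / real n)\<^sup>2)"
      by (intro mult_left_mono) auto
    also have "\<dots> = K\<^sup>2 * (1 - p)\<^sup>2 * (real k)\<^sup>2 / real n"
      using n by (simp add: power2_eq_square)
    finally show ?thesis
      by (intro mult_left_mono) (auto simp: power_mult_distrib)
  qed
  finally show "(low_degree_LR_norm D k n l p)\<^sup>2 \<le> 1 + 2 ^ (D * D) *
      ((exp ((real l)\<^sup>2 / real k) - 1) * exp (K\<^sup>2 * (1 - p)\<^sup>2 * (real k)\<^sup>2 / real n))"
    unfolding sq split by simp
qed

section \<open>The two regimes\<close>

text \<open>The unrounded value x satisfies (1 - p) x^2 = n^(1 + 2\<epsilon>) and x \<ge> sqrt n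
  \<ge> 2. Rounding by less than 1 thus keeps \<open>k\<close> between x/2 and 2x, whence the
  factors 4.\<close>

lemma regime_bounds:
  assumes reg: "regime \<epsilon> n p \<gamma> k l" and \<epsilon>: "0 < \<epsilon>" and n: "4 \<le> n"
  shows "1/2 \<le> p" "p < 1" "model_ok k n l p" "1 - p = real n powr (- \<gamma>)" "2 \<le> k"
    "sqrt (real n) / 2 \<le> real k"
    "real n powr (1 + 2 * \<epsilon>) / 4 \<le> (1 - p) * (real k)\<^sup>2"
    "(1 - p) * (real k)\<^sup>2 \<le> 4 * real n powr (1 + 2 * \<epsilon>)"
proof -
  define x where "x = real n powr (1/2 + \<epsilon>) / sqrt (1 - p)"
  show p1: "1/2 \<le> p" and ok: "model_ok k n l p" and q: "1 - p = real n powr (- \<gamma>)"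
    using reg by (auto simp: regime_def)
  have kx: "\<bar>real k - x\<bar> < 1" using reg unfolding regime_def x_def by blast
  have "0 < real n powr (- \<gamma>)" using n by simp
  then show p2: "p < 1" using q by linarith
  have n2: "2 \<le> sqrt (real n)" using n by (intro real_le_rsqrt) auto
  have "sqrt (real n) \<le> real n powr (1/2 + \<epsilon>)"
    using n \<epsilon> by (subst powr_half_sqrt[symmetric]) (auto intro: powr_mono)
  also have "\<dots> \<le> x"
    unfolding x_def using p1 p2 n by (simp add: pos_le_divide_eq mult_left_le)
  finally have x: "sqrt (real n) \<le> x" .
  have kx2: "x / 2 < real k" "real k \<le> 2 * x" using kx x n2 by auto
  then have "1 < real k" using x n2 by linarith
  then show "2 \<le> k" by simp
  show "sqrt (real n) / 2 \<le> real k" using kx2 x by simp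
  have "(real n powr (1/2 + \<epsilon>))\<^sup>2 = real n powr (1 + 2 * \<epsilon>)"
    by (simp add: power2_eq_square powr_add[symmetric])
  then have xx: "(1 - p) * x\<^sup>2 = real n powr (1 + 2 * \<epsilon>)"
    using p2 by (simp add: x_def power_divide)
  have "(x / 2)\<^sup>2 \<le> (real k)\<^sup>2" using kx2 x n2 by (intro power_mono) auto
  then have "(1 - p) * (x / 2)\<^sup>2 \<le> (1 - p) * (real k)\<^sup>2" using p2 by (intro mult_left_mono) auto
  then show "real n powr (1 + 2 * \<epsilon>) / 4 \<le> (1 - p) * (real k)\<^sup>2"
    unfolding xx[symmetric] by (simp add: power_divide)
  have "(real k)\<^sup>2 \<le> (2 * x)\<^sup>2" using kx2 by (intro power_mono) auto
  then have "(1 - p) * (real k)\<^sup>2 \<le> (1 - p) * (2 * x)\<^sup>2" using p2 by (intro mult_left_mono) auto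
  then show "(1 - p) * (real k)\<^sup>2 \<le> 4 * real n powr (1 + 2 * \<epsilon>)"
    unfolding xx[symmetric] by (simp add: power_mult_distrib)
qed

section \<open>Convergence to 1 for \<open>\<epsilon> \<le> \<gamma> / 2\<close>\<close>

lemma low_degree_LR_norm_sq_le_regime:
  fixes D :: nat
  assumes reg: "regime \<epsilon> n p \<gamma> k l" and \<epsilon>: "0 < \<epsilon>" "\<epsilon> \<le> \<gamma> / 2" and n: "4 \<le> n"
    and l: "real l \<le> real n powr (1/4 - 0.001)"
    and \<delta>: "0 < \<delta>" "real k \<le> (1 - \<delta>) * real n"
  defines "K \<equiv> 2 * (1 + (1 / \<delta>) ^ D)"
  shows "1 \<le> (low_degree_LR_norm D k n l p)\<^sup>2"
    and "(low_degree_LR_norm D k n l p)\<^sup>2 \<le> 1 + 2 ^ (D * D) *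
      ((exp (2 * real n powr - 0.002) - 1) * exp (4 * K\<^sup>2))"
proof -
  note rb = regime_bounds[OF reg \<epsilon>(1) n]
  have k0: "0 < k" and n0: "0 < n" using rb(5) n by auto
  note b = low_degree_LR_norm_bounds[OF rb(1,2) k0 n0 rb(3) \<delta>, of D, folded K_def]
  show "1 \<le> (low_degree_LR_norm D k n l p)\<^sup>2" by (rule b)
  \<comment> \<open>The square of the bound on \<open>l\<close> has exponent 1/2 - 0.002, just below
    that of \<open>sqrt (real n)\<close>.\<close>
  have "(real l)\<^sup>2 / real k \<le> (real n powr (1/4 - 0.001))\<^sup>2 / (sqrt (real n) / 2)"
    using l rb(6) n0 by (intro frac_le power_mono) auto
  also have "\<dots> = 2 * (real n powr (1/2 - 0.002) / real n powr (1/2))"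
    using n0 by (simp add: power2_eq_square powr_add[symmetric] powr_half_sqrt)
  also have "real n powr (1/2 - 0.002) / real n powr (1/2) = real n powr - 0.002"
    by (simp add: powr_diff[symmetric])
  finally have 1: "(real l)\<^sup>2 / real k \<le> 2 * real n powr - 0.002" .
  have "(1 - p)\<^sup>2 * (real k)\<^sup>2 / real n = (1 - p) * ((1 - p) * (real k)\<^sup>2) / real n"
    by (simp add: power2_eq_square)
  also have "\<dots> \<le> (1 - p) * (4 * real n powr (1 + 2 * \<epsilon>)) / real n"
    using rb n0 by (intro divide_right_mono mult_left_mono) auto
  also have "\<dots> = 4 * real n powr (2 * \<epsilon> - \<gamma>)"
    unfolding rb(4) using n0 by (simp add: powr_add powr_diff powr_minus field_simps)
  \<comment> \<open>Here \<open>\<epsilon> \<le> \<gamma> / 2\<close> makes the exponent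
    nonpositive.\<close>
  also have "\<dots> \<le> 4"
    using \<epsilon> n0 powr_mono[of "2 * \<epsilon> - \<gamma>" 0 "real n"] by simp
  finally have "K\<^sup>2 * ((1 - p)\<^sup>2 * (real k)\<^sup>2 / real n) \<le> K\<^sup>2 * 4"
    by (intro mult_left_mono) auto
  then have 2: "K\<^sup>2 * (1 - p)\<^sup>2 * (real k)\<^sup>2 / real n \<le> 4 * K\<^sup>2" by (simp add: mult_ac)
  have "(exp ((real l)\<^sup>2 / real k) - 1) * exp (K\<^sup>2 * (1 - p)\<^sup>2 * (real k)\<^sup>2 / real n) \<le>
      (exp (2 * real n powr - 0.002) - 1) * exp (4 * K\<^sup>2)"
    using 1 2 by (intro mult_mono) auto
  then show "(low_degree_LR_norm D k n l p)\<^sup>2 \<le> 1 + 2 ^ (D * D) *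
      ((exp (2 * real n powr - 0.002) - 1) * exp (4 * K\<^sup>2))"
    by (intro order_trans[OF b(2)] add_left_mono mult_left_mono) auto
qed

lemma low_degree_LR_norm_nonneg:
  "0 < p \<Longrightarrow> p < 1 \<Longrightarrow> 0 \<le> low_degree_LR_norm D k n l p"
  by (simp add: low_degree_LR_norm_eq sum_nonneg)

text \<open>A sandwich for the squared norm: \<open>exp (2 * real n powr - 0.002) - 1\<close>
  vanishes in the limit, and its cofactors depend on \<open>D\<close> and \<delta> only.\<close>

lemma low_degree_LR_norm_tendsto_1:
  assumes \<epsilon>: "0 < \<epsilon>" and \<delta>: "0 < \<delta>"
    and ev: "\<forall>\<^sub>F n in sequentially. regime \<epsilon> n (p n) (\<gamma> n) (k n) (l n) \<and> \<epsilon> \<le> \<gamma> n / 2 \<and>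
            real (l n) \<le> real n powr (1/4 - 0.001) \<and> real (k n) \<le> (1 - \<delta>) * real n"
  shows "(\<lambda>n. low_degree_LR_norm D (k n) n (l n) (p n)) \<longlonglongrightarrow> 1"
proof -
  let ?N = "\<lambda>n. low_degree_LR_norm D (k n) n (l n) (p n)"
  define K where "K = 2 * (1 + (1 / \<delta>) ^ D)"
  let ?u = "\<lambda>n. 1 + 2 ^ (D * D) * ((exp (2 * real n powr - 0.002) - 1) * exp (4 * K\<^sup>2))"
  have "(\<lambda>n. real n powr - 0.002) \<longlonglongrightarrow> 0"
    by (intro tendsto_neg_powr filterlim_real_sequentially) simp
  then have "?u \<longlonglongrightarrow> 1 + 2 ^ (D * D) * ((exp (2 * 0) - 1) * exp (4 * K\<^sup>2))"
    by (intro tendsto_intros)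
  then have u: "?u \<longlonglongrightarrow> 1" by simp
  have ev2: "\<forall>\<^sub>F n in sequentially. 1 \<le> (?N n)\<^sup>2 \<and> (?N n)\<^sup>2 \<le> ?u n \<and> 0 \<le> ?N n"
    using ev eventually_ge_at_top[of 4]
  proof eventually_elim
    case (elim n)
    then have r: "regime \<epsilon> n (p n) (\<gamma> n) (k n) (l n)" and a: "\<epsilon> \<le> \<gamma> n / 2"
      "real (l n) \<le> real n powr (1/4 - 0.001)" "real (k n) \<le> (1 - \<delta>) * real n" by auto
    have "0 < p n" "p n < 1" using regime_bounds[OF r \<epsilon> elim(2)] by auto
    then show ?case
      using low_degree_LR_norm_sq_le_regime[OF r \<epsilon> a(1) elim(2) a(2) \<delta> a(3), of D]
      unfolding K_def by (auto intro: low_degree_LR_norm_nonneg)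
  qed
  have "(\<lambda>n. (?N n)\<^sup>2) \<longlonglongrightarrow> 1"
    by (rule tendsto_sandwich[OF _ _ tendsto_const u]) (use ev2 in \<open>auto elim: eventually_mono\<close>)
  then have "(\<lambda>n. sqrt ((?N n)\<^sup>2)) \<longlonglongrightarrow> sqrt 1" by (rule tendsto_real_sqrt)
  then show ?thesis
    unfolding real_sqrt_one
    by (rule Lim_transform_eventually) (use ev2 in \<open>auto elim: eventually_mono\<close>)
qed

section \<open>Divergence for \<open>\<gamma> \<le> \<epsilon>\<close>\<close>

text \<open>The edge sets of the complete bipartite graphs \<open>K\<^sub>2\<^sub>,\<^sub>m\<close> alone give this lower bound.\<close>

lemma low_degree_LR_norm_sq_ge:
  assumes p: "0 < p" "p < 1" and k: "2 \<le> k" and m: "1 \<le> m" "m \<le> n" "2 * m \<le> D"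
    and ok: "model_ok k n l p"
  shows "(real k / 2)\<^sup>2 * (real l / real k) ^ 4 *
           (real n / real m * ((1 - p) * ((real k - real l) / real n))\<^sup>2) ^ m
         \<le> (low_degree_LR_norm D k n l p)\<^sup>2"
proof -
  define a where "a = (real k - real l) / real n"
  define b where "b = (1 - p) * a"
  let ?c = "planted_coeff k n l p"
  let ?Z = "{A. A \<subseteq> {..<k} \<and> card A = 2} \<times> {B. B \<subseteq> {..<n} \<and> card B = m}"
  let ?h = "\<lambda>(A, B). A \<times> B"
  have n: "0 < n" and k0: "0 < k" using m k by auto
  have a: "0 \<le> a" "a \<le> p" using ok n by (auto simp: a_def model_ok_def field_simps)
  have b: "0 \<le> b" "b \<le> bias_moment p a 2"
  proof -
    show "0 \<le> b" using a p by (simp add: b_def)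
    \<comment> \<open>Dividing by \<open>p\<close> and by \<open>1 - a\<close>, both in (0, 1], only
      increases the second moment.\<close>
    have "1 - p \<le> (1 - p) / p" using p by (simp add: pos_le_divide_eq mult_left_le)
    moreover have "a \<le> a / (1 - a)" using a p by (simp add: pos_le_divide_eq mult_left_le)
    ultimately have "(1 - p) * a \<le> (1 - p) / p * (a / (1 - a))"
      using a p by (intro mult_mono) auto
    then show "b \<le> bias_moment p a 2" using a p by (simp add: bias_moment_2 b_def)
  qed
  \<comment> \<open>A product of nonempty sets determines its factors; \<open>1 \<le> m\<close>
    excludes an empty \<open>B\<close>.\<close>
  have inj: "inj_on ?h ?Z"
  proof (rule inj_onI)
    fix z z' assume h: "z \<in> ?Z" "z' \<in> ?Z" "?h z = ?h z'"
    then have "fst z \<times> snd z = fst z' \<times> snd z'" "fst z \<noteq> {}" "snd z \<noteq> {}"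
      using m by (auto simp: case_prod_unfold)
    then show "z = z'" by (simp add: times_eq_iff prod_eq_iff)
  qed
  have sub: "?h ` ?Z \<subseteq> edge_sets k n D"
    using m by (auto simp: edge_sets_def vpairs_def card_cartesian_product)
  have c: "((real l / real k)\<^sup>2 * b ^ m)\<^sup>2 \<le> (?c (?h z))\<^sup>2" if z: "z \<in> ?Z" for z
  proof -
    obtain A B where AB: "z = (A, B)" "A \<subseteq> {..<k}" "card A = 2" "B \<subseteq> {..<n}" "card B = m"
      using z by blast
    then have "A \<noteq> {}" "B \<noteq> {}" using m by auto
    have "right_degree (A \<times> B) v = 2" if "v \<in> B" for v
    proof -
      have "{e \<in> A \<times> B. snd e = v} = A \<times> {v}" using that by auto
      then show ?thesis using AB by (simp add: right_degree_def card_cartesian_product)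
    qed
    moreover have "A \<times> B \<subseteq> vpairs k n" using AB by (auto simp: vpairs_def)
    ultimately have "?c (A \<times> B) = (real l / real k)\<^sup>2 * bias_moment p a 2 ^ m"
      using planted_coeff_eq[OF p k0 n ok, of "A \<times> B"] AB \<open>A \<noteq> {}\<close> \<open>B \<noteq> {}\<close>
      by (simp add: a_def fst_image_times snd_image_times)
    then show ?thesis
      unfolding AB(1) using b by (auto intro!: power_mono mult_left_mono)
  qed
  \<comment> \<open>The number of copies is a product of binomial coefficients, each bounded below
    by (N / j)^j.\<close>
  have "(real k / 2)\<^sup>2 \<le> real (k choose 2)"
    using binomial_ge_n_over_k_pow_k[of 2 k, where 'a = real] k by simp
  moreover have "(real n / real m) ^ m \<le> real (n choose m)"
    using binomial_ge_n_over_k_pow_k[of m n, where 'a = real] m by simp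
  ultimately have "(real k / 2)\<^sup>2 * (real n / real m) ^ m * ((real l / real k)\<^sup>2 * b ^ m)\<^sup>2 \<le>
      real (k choose 2) * real (n choose m) * ((real l / real k)\<^sup>2 * b ^ m)\<^sup>2"
    by (intro mult_right_mono mult_mono) auto
  also have "\<dots> = (\<Sum>z\<in>?Z. ((real l / real k)\<^sup>2 * b ^ m)\<^sup>2)"
    using n_subsets[of "{..<k}" 2] n_subsets[of "{..<n}" m] by (simp add: card_cartesian_product)
  also have "\<dots> \<le> (\<Sum>z\<in>?Z. (?c (?h z))\<^sup>2)" by (rule sum_mono[OF c])
  also have "\<dots> = (\<Sum>T\<in>?h ` ?Z. (?c T)\<^sup>2)" by (simp add: sum.reindex[OF inj])
  also have "\<dots> \<le> (\<Sum>T\<in>edge_sets k n D. (?c T)\<^sup>2)" by (rule sum_mono2[OF _ sub]) auto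
  also have "\<dots> = (low_degree_LR_norm D k n l p)\<^sup>2"
    using low_degree_LR_norm_eq[OF p] by (simp add: sum_nonneg)
  also have "(real k / 2)\<^sup>2 * (real n / real m) ^ m * ((real l / real k)\<^sup>2 * b ^ m)\<^sup>2 =
      (real k / 2)\<^sup>2 * (real l / real k) ^ 4 * (real n / real m * b\<^sup>2) ^ m"
    by (simp only: power_mult_distrib power_mult[symmetric] mult_ac) simp
  finally show ?thesis by (simp add: a_def b_def)
qed

text \<open>The case split is at \<open>l = k / 2\<close>. The exponent
  \<open>min \<epsilon> 1\<close> serves both cases: one gives \<epsilon>, the other \<epsilon> m -
  2 \<ge> 1.\<close>

lemma low_degree_LR_norm_sq_ge_regime:
  assumes reg: "regime \<epsilon> n p \<gamma> k l" and \<epsilon>: "0 < \<epsilon>" "\<gamma> \<le> \<epsilon>" and n: "4 \<le> n"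
    and l: "0 < l" "l < k" and m: "3 \<le> \<epsilon> * real m" "m \<le> n" "2 * m \<le> D"
  shows "real n powr min \<epsilon> 1 / (256 * (16 * real m) ^ m) \<le> (low_degree_LR_norm D k n l p)\<^sup>2"
proof -
  note rb = regime_bounds[OF reg \<epsilon>(1) n]
  have p: "0 < p" "p < 1" using rb by auto
  have n0: "0 < real n" "1 \<le> real n" using n by auto
  have k0: "0 < real k" using rb(5) by simp
  have m1: "1 \<le> m" using m(1) \<epsilon>(1) by (cases m) auto
  have ok: "real k - real l \<le> real n * p" using rb(3) by (simp add: model_ok_def)
  let ?R = "(low_degree_LR_norm D k n l p)\<^sup>2"
  have mm: "1 \<le> (16 * real m) ^ m" using m1 by (intro one_le_power) auto
  \<comment> \<open>This is where \<open>\<gamma> \<le> \<epsilon>\<close> enters: 2\<epsilon> -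
    \<gamma> \<ge> \<epsilon>.\<close>
  have qn: "real n powr \<epsilon> \<le> (1 - p) * real n powr (2 * \<epsilon>)"
  proof -
    have "real n powr \<epsilon> \<le> real n powr (- \<gamma> + 2 * \<epsilon>)" using \<epsilon> n0 by (intro powr_mono) auto
    then show ?thesis unfolding rb(4) by (simp only: powr_add)
  qed
  have nn: "real n powr (1 + 2 * \<epsilon>) = real n * real n powr (2 * \<epsilon>)"
    using n0 by (simp add: powr_add)
  show ?thesis
  proof (cases "real k \<le> 2 * real l")
    case True
    have "real n powr min \<epsilon> 1 \<le> real n powr \<epsilon>" using n0 by (intro powr_mono) auto
    also have "\<dots> \<le> (1 - p) * real n powr (2 * \<epsilon>)" by (rule qn)
    also have "\<dots> = (1 - p) * (real n powr (1 + 2 * \<epsilon>) / 4) * (4 / real n)"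
      unfolding nn using n0 by simp
    also have "\<dots> \<le> (1 - p) * ((1 - p) * (real k)\<^sup>2) * (4 / real n)"
      using rb p by (intro mult_right_mono mult_left_mono) auto
    also have "\<dots> = 256 * ((1 - p)\<^sup>2 * (real k)\<^sup>2 / (64 * real n))"
      using n0 by (simp add: power2_eq_square field_simps)
    finally have 1: "real n powr min \<epsilon> 1 / 256 \<le> (1 - p)\<^sup>2 * (real k)\<^sup>2 / (64 * real n)"
      by simp
    have "(1 / 2 :: real) ^ 4 \<le> (real l / real k) ^ 4"
      using True k0 by (intro power_mono) (auto simp: field_simps)
    then have h: "1 / 16 \<le> (real l / real k) ^ 4" by (simp add: power_divide)
    \<comment> \<open>Here \<open>k - l\<close> can be as small as 1, so only a \<ge> 1/n is
      available; the factor (k / 2)^2 makes up for it.\<close>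
    have "1 \<le> real k - real l" using l by simp
    then have "1\<^sup>2 \<le> (real k - real l)\<^sup>2" by (intro power_mono) auto
    then have g: "(1 - p)\<^sup>2 * 1 / real n \<le> (1 - p)\<^sup>2 * (real k - real l)\<^sup>2 / real n"
      using n0 by (intro divide_right_mono mult_left_mono) auto
    have "(1 - p)\<^sup>2 * (real k)\<^sup>2 / (64 * real n) = (real k / 2)\<^sup>2 * (1 / 16) * ((1 - p)\<^sup>2 * 1 / real n)"
      by (simp add: power_divide)
    also have "\<dots> \<le> (real k / 2)\<^sup>2 * (real l / real k) ^ 4 * ((1 - p)\<^sup>2 * (real k - real l)\<^sup>2 / real n)"
      using h g n0 by (intro mult_mono) auto
    also have "\<dots> = (real k / 2)\<^sup>2 * (real l / real k) ^ 4 *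
        (real n / real 1 * ((1 - p) * ((real k - real l) / real n))\<^sup>2) ^ 1"
      using n0 by (simp add: power_mult_distrib power_divide power2_eq_square)
    also have "\<dots> \<le> ?R"
      by (rule low_degree_LR_norm_sq_ge[OF p rb(5) _ _ _ rb(3)]) (use m m1 n in auto)
    finally have 2: "(1 - p)\<^sup>2 * (real k)\<^sup>2 / (64 * real n) \<le> ?R" .
    have "real n powr min \<epsilon> 1 / (256 * (16 * real m) ^ m) \<le> real n powr min \<epsilon> 1 / 256"
      using mm by (intro divide_left_mono) auto
    with 1 2 show ?thesis by linarith
  next
    case False
    have kl: "real k / 2 \<le> real k - real l" using False by simp
    have "real n * p \<le> real n" using p n0 by (simp add: mult_left_le)
    \<comment> \<open>Since k - l \<ge> k/2, \<open>model_ok\<close> bounds \<open>k\<close>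
      linearly in \<open>n\<close>; with l \<ge> 1 the left factor is then at least of order
      n^(-2).\<close>
    then have k2: "real k \<le> 2 * real n" using kl ok by linarith
    have "real n powr \<epsilon> / (16 * real m) \<le> (1 - p) * real n powr (2 * \<epsilon>) / (16 * real m)"
      using qn by (intro divide_right_mono) auto
    also have "\<dots> = (1 - p) * (real n powr (1 + 2 * \<epsilon>) / 4) / (4 * real m * real n)"
      unfolding nn using n0 by simp
    also have "\<dots> \<le> (1 - p) * ((1 - p) * (real k)\<^sup>2) / (4 * real m * real n)"
      using rb p by (intro divide_right_mono mult_left_mono) auto
    also have "\<dots> = real n / real m * ((1 - p) * ((real k / 2) / real n))\<^sup>2"
      using n0 by (simp add: power_mult_distrib power_divide power2_eq_square mult_ac)
    also have "\<dots> \<le> real n / real m * ((1 - p) * ((real k - real l) / real n))\<^sup>2"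
      using kl p n0 by (intro mult_left_mono power_mono divide_right_mono) auto
    finally have 1: "(real n powr \<epsilon> / (16 * real m)) ^ m \<le>
        (real n / real m * ((1 - p) * ((real k - real l) / real n))\<^sup>2) ^ m"
      by (intro power_mono) auto
    have "1 / (16 * (real n)\<^sup>2) \<le> 1 / (4 * (real k)\<^sup>2)"
      using power_mono[OF k2, of 2] k0 n0 by (intro divide_left_mono) (auto simp: power_mult_distrib)
    also have "\<dots> = (real k / 2)\<^sup>2 * (1 / real k) ^ 4"
      using k0 by (simp add: power_divide field_simps power2_eq_square power4_eq_xxxx)
    also have "\<dots> \<le> (real k / 2)\<^sup>2 * (real l / real k) ^ 4"
      using l k0 by (intro mult_left_mono power_mono divide_right_mono) auto
    finally have 2: "1 / (16 * (real n)\<^sup>2) \<le> (real k / 2)\<^sup>2 * (real l / real k) ^ 4" .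
    \<comment> \<open>From \<epsilon> m \<ge> 3, the gain n^(\<epsilon> m) beats that loss with a
      factor \<open>n\<close> to spare.\<close>
    have "real n powr min \<epsilon> 1 \<le> real n powr (\<epsilon> * real m - 2)"
      using n0 m by (intro powr_mono) auto
    also have "\<dots> = real n powr (\<epsilon> * real m) / (real n)\<^sup>2"
      using n0 by (simp add: powr_diff powr_numeral)
    also have "real n powr (\<epsilon> * real m) = (real n powr \<epsilon>) ^ m"
      using n0 by (simp add: powr_powr[symmetric] powr_realpow)
    finally have "real n powr min \<epsilon> 1 / (16 * (16 * real m) ^ m) \<le>
        (real n powr \<epsilon>) ^ m / (real n)\<^sup>2 / (16 * (16 * real m) ^ m)"
      by (intro divide_right_mono) auto
    also have "\<dots> = 1 / (16 * (real n)\<^sup>2) * (real n powr \<epsilon> / (16 * real m)) ^ m"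
      by (simp add: power_divide)
    also have "\<dots> \<le> (real k / 2)\<^sup>2 * (real l / real k) ^ 4 *
           (real n / real m * ((1 - p) * ((real k - real l) / real n))\<^sup>2) ^ m"
      using 1 2 by (intro mult_mono) auto
    also have "\<dots> \<le> ?R"
      by (rule low_degree_LR_norm_sq_ge[OF p rb(5) m1 m(2,3) rb(3)])
    finally have 3: "real n powr min \<epsilon> 1 / (16 * (16 * real m) ^ m) \<le> ?R" .
    have "real n powr min \<epsilon> 1 / (256 * (16 * real m) ^ m) \<le> real n powr min \<epsilon> 1 / (16 * (16 * real m) ^ m)"
      using m1 by (intro divide_left_mono) auto
    with 3 show ?thesis by linarith
  qed
qed

text \<open>With \<open>m\<close> fixed, the lower bound is a positive constant times n^(min
  \<epsilon> 1), which diverges.\<close>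

lemma low_degree_LR_norm_at_top:
  assumes \<epsilon>: "0 < \<epsilon>" and D: "12 / \<epsilon> \<le> real D" "2 \<le> D"
    and ev: "\<forall>\<^sub>F n in sequentially. regime \<epsilon> n (p n) (\<gamma> n) (k n) (l n) \<and> \<gamma> n \<le> \<epsilon> \<and>
            0 < l n \<and> l n < k n"
  shows "filterlim (\<lambda>n. low_degree_LR_norm D (k n) n (l n) (p n)) at_top sequentially"
proof -
  let ?N = "\<lambda>n. low_degree_LR_norm D (k n) n (l n) (p n)"
  \<comment> \<open>The least integer with \<epsilon> m \<ge> 3.\<close>
  define m where "m = nat \<lceil>3 / \<epsilon>\<rceil>"
  have "0 < 3 / \<epsilon>" using \<epsilon> by simp
  then have m: "3 / \<epsilon> \<le> real m" "real m < 3 / \<epsilon> + 1"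
    unfolding m_def by linarith+
  have m3: "3 \<le> \<epsilon> * real m" using m(1) \<epsilon> by (simp add: field_simps)
  \<comment> \<open>For \<epsilon> < 3, 2m < 6/\<epsilon> + 2 \<le> 12/\<epsilon>, the source of the
    constant 12. For larger \<epsilon>, \<open>m \<le> 1\<close> and \<open>2 \<le> D\<close>
    suffices.\<close>
  have mD: "2 * m \<le> D"
  proof (cases "3 \<le> \<epsilon>")
    case True
    then have "3 / \<epsilon> \<le> 1" by simp
    then have "m \<le> 1" unfolding m_def by (simp add: ceiling_le_iff)
    then show ?thesis using D by simp
  next
    case False
    then have "1 \<le> 3 / \<epsilon>" using \<epsilon> by (simp add: field_simps)
    then have "real (2 * m) \<le> 12 / \<epsilon>" using m(2) by simp
    then show ?thesis using D(1) by linarith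
  qed
  have m0: "0 < real m" using m(1) \<open>0 < 3 / \<epsilon>\<close> by linarith
  define c where "c = 1 / (256 * (16 * real m) ^ m)"
  have c: "0 < c" using m0 by (simp add: c_def)
  have "filterlim (\<lambda>n. exp (min \<epsilon> 1 * ln (real n))) at_top sequentially"
    using \<epsilon> by (intro filterlim_compose[OF exp_at_top] filterlim_tendsto_pos_mult_at_top[OF tendsto_const]
        filterlim_compose[OF ln_at_top filterlim_real_sequentially]) auto
  then have "filterlim (\<lambda>n. real n powr min \<epsilon> 1) at_top sequentially"
    by (rule filterlim_at_top_mono)
       (use eventually_gt_at_top[of 0] in \<open>auto simp: powr_def elim: eventually_mono\<close>)
  then have "filterlim (\<lambda>n. c * real n powr min \<epsilon> 1) at_top sequentially"
    by (rule filterlim_tendsto_pos_mult_at_top[OF tendsto_const c])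
  then have lim: "filterlim (\<lambda>n. sqrt (c * real n powr min \<epsilon> 1)) at_top sequentially"
    by (rule filterlim_compose[OF sqrt_at_top])
  show ?thesis
  proof (rule filterlim_at_top_mono[OF lim])
    show "\<forall>\<^sub>F n in sequentially. sqrt (c * real n powr min \<epsilon> 1) \<le> ?N n"
      using ev eventually_ge_at_top[of 4] eventually_ge_at_top[of m]
    proof eventually_elim
      case (elim n)
      then have r: "regime \<epsilon> n (p n) (\<gamma> n) (k n) (l n)" and a: "\<gamma> n \<le> \<epsilon>" "0 < l n" "l n < k n" by auto
      have "0 < p n" "p n < 1" using regime_bounds[OF r \<epsilon> elim(2)] by auto
      then have "0 \<le> ?N n" by (rule low_degree_LR_norm_nonneg)
      moreover have "c * real n powr min \<epsilon> 1 \<le> (?N n)\<^sup>2"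
        using low_degree_LR_norm_sq_ge_regime[OF r \<epsilon> a(1) elim(2) a(2,3) m3 elim(3) mD]
        by (simp add: c_def)
      ultimately show ?case by (rule real_le_lsqrt)
    qed
  qed
qed

text \<open>The second half excludes degenerate cases of norm 1: for \<open>l = 0\<close> or
  \<open>l = k\<close> all nonempty coefficients vanish, and for \<open>D < 2\<close> every right
  degree is at most 1. In the first half, \<delta> keeps the moment constants bounded.\<close>

theorem mainTheorem5:
  shows
   "(\<forall>\<epsilon>>0. \<forall>f :: real \<Rightarrow> nat. \<forall>\<delta>>0.
       \<forall>(p :: nat \<Rightarrow> real) (\<gamma> :: nat \<Rightarrow> real) (k :: nat \<Rightarrow> nat) (l :: nat \<Rightarrow> nat).
         (\<forall>\<^sub>F n in sequentially.
            regime \<epsilon> n (p n) (\<gamma> n) (k n) (l n) \<and>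
            \<epsilon> \<le> \<gamma> n / 2 \<and>
            real (l n) \<le> real n powr (1/4 - 0.001) \<and>
            real (k n) \<le> (1 - \<delta>) * real n)
         \<longrightarrow> (\<lambda>n. low_degree_LR_norm (f (1/\<epsilon>)) (k n) n (l n) (p n)) \<longlonglongrightarrow> 1)
    \<and>
    (\<exists>C>0. \<forall>\<epsilon>>0. \<forall>D :: nat. real D \<ge> C / \<epsilon> \<and> D \<ge> 2 \<longrightarrow>
       (\<forall>(p :: nat \<Rightarrow> real) (\<gamma> :: nat \<Rightarrow> real) (k :: nat \<Rightarrow> nat) (l :: nat \<Rightarrow> nat).
         (\<forall>\<^sub>F n in sequentially.
            regime \<epsilon> n (p n) (\<gamma> n) (k n) (l n) \<and>
            \<epsilon> \<ge> \<gamma> n \<and>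
            0 < l n \<and> l n < k n)
         \<longrightarrow> filterlim (\<lambda>n. low_degree_LR_norm D (k n) n (l n) (p n)) at_top sequentially))"
proof (intro conjI allI impI)
  show "\<exists>C>0. \<forall>\<epsilon>>0. \<forall>D :: nat. real D \<ge> C / \<epsilon> \<and> D \<ge> 2 \<longrightarrow>
       (\<forall>(p :: nat \<Rightarrow> real) (\<gamma> :: nat \<Rightarrow> real) (k :: nat \<Rightarrow> nat) (l :: nat \<Rightarrow> nat).
         (\<forall>\<^sub>F n in sequentially.
            regime \<epsilon> n (p n) (\<gamma> n) (k n) (l n) \<and>
            \<epsilon> \<ge> \<gamma> n \<and>
            0 < l n \<and> l n < k n)
         \<longrightarrow> filterlim (\<lambda>n. low_degree_LR_norm D (k n) n (l n) (p n)) at_top sequentially)"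
    by (intro exI[of _ 12] conjI allI impI low_degree_LR_norm_at_top) auto
qed (rule low_degree_LR_norm_tendsto_1)

end
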